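(* Let $\mathcal{SW}$ be a spiderweb rooted at infinity such that every pair of vertices can be joined by a standard geodesic whose horizontal component has uniformly bounded length (i.e. there is a constant $L_0$, independent of the pair, such that every pair of vertices is joined by a standard geodesic with horizontal component of length at most $L_0$). Let $\mu$ be any locally doubling quasi-flow on $\mathcal{SW}$. Then, for every $p\in[1,\infty)$, there exists a constant $C_p$ such that for every $x_c\in\mathcal{SW}$, every $r>0$ and every function $f:\mathcal{SW}\to\mathbb C$, $$\sum_{x\in B_{\mathcal{SW}}(x_c,r)}|f(x)-f_{B_{\mathcal{SW}}(x_c,r)}|^p\mu(x)\le C_p\,r^p\sum_{x\in B_{\mathcal{SW}}(x_c,r)}|\nabla f(x)|^p\mu(x).$$
   Context: Graphs have a countable vertex set, unoriented edges, and are connected; $x\in\mathcal G$ means $x$ is a vertex, $x\sim y$ means $x,y$ are joined by an edge, $d_{\mathcal G}$ is the graph distance, $B_{\mathcal G}(x,r)$ is the closed ball. The length of a path is its number of edges. For $f$ on a graph, $|\nabla f(x)|=\sum_{y\sim x}|f(x)-f(y)|$ (sum over all neighbours of $x$ in the graph). For a ball $B$, $f_B=\mu(B)^{-1}\sum_{x\in B}f(x)\mu(x)$, where $\mu(B)=\sum_{x\in B}\mu(x)$. A spiderweb rooted at infinity is a connected graph $\mathcal{SW}$ with a height function $\mathfrak h:\mathcal{SW}\to\mathbb Z$ and a predecessor map $p:\mathcal{SW}\to\mathcal{SW}$ such that: (1) for every $x$, $x\sim p(x)$ and $\mathfrak h(p(x))=\mathfrak h(x)+1$ (edges $\{x,p(x)\}$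 are called vertical); (2) every nonvertical edge joins two distinct vertices of the same height (such edges are called horizontal); (3) if $x,y$ are joined by a horizontal edge, then either $p(x)=p(y)$ or $p(x)$ and $p(y)$ are joined by a horizontal edge. Write $p^0(x)=x$, $p^m(x)=p(p^{m-1}(x))$, $s(x)=\{y:p(y)=x\}$, $s_0(x)=\{x\}$, $s_m(x)=\bigcup_{y\in s_{m-1}(x)}s(y)$. For vertices $x,y$ and $h\ge\max\{\mathfrak h(x),\mathfrak h(y)\}$, $\Gamma(x,y;h)$ is the (possibly empty) family of paths obtained by ascending vertically from $x$ to $p^{h-\mathfrak h(x)}(x)$, then following a horizontal path (all vertices at height $h$) from $p^{h-\mathfrak h(x)}(x)$ to $p^{h-\mathfrak h(y)}(y)$ (its horizontal component), then descending vertically to $y$. A geodesic joining $x$ and $y$ is standard if it belongs to $\Gamma(x,y;h)$ for some such $h$. A function $\mu:\mathcal{SW}\to(0,\infty)$ (identified with a measure) is a quasi-flow if there is $C\ge1$ with $\sum_{y\in s_n(x)}\mu(y)\le C\mu(x)$ for every $n\in\mathbb N$ and $x\in\mathcal{SW}$. It is locally doubling if for every $R>0$ there is $C_R>0$ with $\mu(B_{\mathcal{SW}}(x,2r))\le C_R\,\mu(B_{\mathcal{SW}}(x,r))$ for all $x\in\mathcal{SW}$ and $r\in(0,R]$. *)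

theory Defs
  imports "HOL-Analysis.Analysis"
begin

section \<open>Connected graphs\<close>

text \<open>A graph is given by its adjacency relation; the vertex set is the whole (countable) type.\<close>

definition walk :: "('a \<Rightarrow> 'a \<Rightarrow> bool) \<Rightarrow> 'a \<Rightarrow> 'a \<Rightarrow> 'a list \<Rightarrow> bool" where
  "walk adj x y xs \<longleftrightarrow> xs \<noteq> [] \<and> hd xs = x \<and> last xs = y \<and> successively adj xs"

text \<open>A walk is the list of the vertices it visits; its length is its number of edges.\<close>

definition walk_length :: "'a list \<Rightarrow> nat" where
  "walk_length xs = length xs - 1"

locale connected_graph =
  fixes adj :: "'a::countable \<Rightarrow> 'a \<Rightarrow> bool"
  assumes adj_sym: "adj x y \<Longrightarrow> adj y x"
    and adj_irrefl: "\<not> adj x x"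
    and connected: "\<exists>xs. walk adj x y xs"

definition graph_dist :: "('a \<Rightarrow> 'a \<Rightarrow> bool) \<Rightarrow> 'a \<Rightarrow> 'a \<Rightarrow> nat" where
  "graph_dist adj x y = (LEAST n. \<exists>xs. walk adj x y xs \<and> walk_length xs = n)"

definition graph_ball :: "('a \<Rightarrow> 'a \<Rightarrow> bool) \<Rightarrow> 'a \<Rightarrow> real \<Rightarrow> 'a set" where
  "graph_ball adj x r = {y. real (graph_dist adj x y) \<le> r}"

definition geodesic :: "('a \<Rightarrow> 'a \<Rightarrow> bool) \<Rightarrow> 'a \<Rightarrow> 'a \<Rightarrow> 'a list \<Rightarrow> bool" where
  "geodesic adj x y xs \<longleftrightarrow> walk adj x y xs \<and> walk_length xs = graph_dist adj x y"

section \<open>Spiderwebs rooted at infinity\<close>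

definition vertical :: "('a \<Rightarrow> 'a) \<Rightarrow> 'a \<Rightarrow> 'a \<Rightarrow> bool" where
  "vertical p x y \<longleftrightarrow> y = p x \<or> x = p y"

definition horizontal :: "('a \<Rightarrow> 'a \<Rightarrow> bool) \<Rightarrow> ('a \<Rightarrow> 'a) \<Rightarrow> 'a \<Rightarrow> 'a \<Rightarrow> bool" where
  "horizontal adj p x y \<longleftrightarrow> adj x y \<and> \<not> vertical p x y"

locale spiderweb = connected_graph adj
  for adj :: "'a::countable \<Rightarrow> 'a \<Rightarrow> bool" +
  fixes h :: "'a \<Rightarrow> int" and p :: "'a \<Rightarrow> 'a"
  assumes adj_pred: "adj x (p x)"
    and height_pred: "h (p x) = h x + 1"
    and horizontal_height: "horizontal adj p x y \<Longrightarrow> x \<noteq> y \<and> h x = h y"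
    and horizontal_pred: "horizontal adj p x y \<Longrightarrow> p x = p y \<or> horizontal adj p (p x) (p y)"

fun descendants :: "('a \<Rightarrow> 'a) \<Rightarrow> nat \<Rightarrow> 'a \<Rightarrow> 'a set" where
  "descendants p 0 x = {x}"
| "descendants p (Suc m) x = (\<Union>y\<in>descendants p m x. {z. p z = y})"

text \<open>The vertices met when ascending from \<open>x\<close> towards height \<open>k\<close>, the top vertex excluded.\<close>

definition ascent :: "('a \<Rightarrow> int) \<Rightarrow> ('a \<Rightarrow> 'a) \<Rightarrow> 'a \<Rightarrow> int \<Rightarrow> 'a list" where
  "ascent h p x k = map (\<lambda>i. (p ^^ i) x) [0..<nat (k - h x)]"

definition horizontal_walk ::
    "('a \<Rightarrow> 'a \<Rightarrow> bool) \<Rightarrow> ('a \<Rightarrow> int) \<Rightarrow> int \<Rightarrow> 'a \<Rightarrow> 'a \<Rightarrow> 'a list \<Rightarrow> bool" where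
  "horizontal_walk adj h k a b zs \<longleftrightarrow> walk adj a b zs \<and> (\<forall>z\<in>set zs. h z = k)"

text \<open>\<open>in_Gamma adj h p x y k zs xs\<close>: the path \<open>xs\<close> belongs to $\Gamma(x,y;k)$ and its
  horizontal component is \<open>zs\<close>.\<close>

definition in_Gamma :: "('a \<Rightarrow> 'a \<Rightarrow> bool) \<Rightarrow> ('a \<Rightarrow> int) \<Rightarrow> ('a \<Rightarrow> 'a) \<Rightarrow>
    'a \<Rightarrow> 'a \<Rightarrow> int \<Rightarrow> 'a list \<Rightarrow> 'a list \<Rightarrow> bool" where
  "in_Gamma adj h p x y k zs xs \<longleftrightarrow>
     horizontal_walk adj h k ((p ^^ nat (k - h x)) x) ((p ^^ nat (k - h y)) y) zs \<and>
     xs = ascent h p x k @ zs @ rev (ascent h p y k)"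

definition standard_geodesic :: "('a \<Rightarrow> 'a \<Rightarrow> bool) \<Rightarrow> ('a \<Rightarrow> int) \<Rightarrow> ('a \<Rightarrow> 'a) \<Rightarrow>
    'a \<Rightarrow> 'a \<Rightarrow> 'a list \<Rightarrow> 'a list \<Rightarrow> bool" where
  "standard_geodesic adj h p x y zs xs \<longleftrightarrow>
     geodesic adj x y xs \<and> (\<exists>k \<ge> max (h x) (h y). in_Gamma adj h p x y k zs xs)"

section \<open>Measures\<close>

text \<open>Total mass with values in $[0,\infty]$, so that sums over infinite sets are meaningful
  in the definitions of quasi-flow and of local doubling.\<close>

definition mass :: "('a \<Rightarrow> real) \<Rightarrow> 'a set \<Rightarrow> ennreal" where
  "mass \<mu> A = (\<Sum>\<^sub>\<infinity>x\<in>A. ennreal (\<mu> x))"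

definition quasi_flow :: "('a \<Rightarrow> 'a) \<Rightarrow> ('a \<Rightarrow> real) \<Rightarrow> bool" where
  "quasi_flow p \<mu> \<longleftrightarrow> (\<forall>x. \<mu> x > 0) \<and>
     (\<exists>C\<ge>1. \<forall>n x. mass \<mu> (descendants p n x) \<le> ennreal (C * \<mu> x))"

definition locally_doubling :: "('a \<Rightarrow> 'a \<Rightarrow> bool) \<Rightarrow> ('a \<Rightarrow> real) \<Rightarrow> bool" where
  "locally_doubling adj \<mu> \<longleftrightarrow>
     (\<forall>R>0. \<exists>C>0. \<forall>x. \<forall>r\<in>{0<..R}.
        mass \<mu> (graph_ball adj x (2 * r)) \<le> ennreal C * mass \<mu> (graph_ball adj x r))"

text \<open>The next two definitions use finite sums. This is harmless: a graph carrying a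
  positive locally doubling measure has finite balls and finite vertex degrees, see
  \<open>finite_graph_ball\<close> and \<open>finite_neighbours\<close> below.\<close>

definition ball_average :: "('a \<Rightarrow> 'a \<Rightarrow> bool) \<Rightarrow> ('a \<Rightarrow> real) \<Rightarrow> 'a \<Rightarrow> real \<Rightarrow>
    ('a \<Rightarrow> complex) \<Rightarrow> complex" where
  "ball_average adj \<mu> x r f =
     (\<Sum>y\<in>graph_ball adj x r. f y * of_real (\<mu> y)) / of_real (\<Sum>y\<in>graph_ball adj x r. \<mu> y)"

definition grad_norm :: "('a \<Rightarrow> 'a \<Rightarrow> bool) \<Rightarrow> ('a \<Rightarrow> complex) \<Rightarrow> 'a \<Rightarrow> real" where
  "grad_norm adj f x = (\<Sum>y\<in>{y. adj x y}. cmod (f x - f y))"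

lemma walk_rev:
  assumes "\<And>x y. adj x y \<Longrightarrow> adj y x" "walk adj x y xs"
  shows "walk adj y x (rev xs)"
  using assms by (auto simp: walk_def hd_rev last_rev elim: successively_mono)

lemma graph_dist_le: "walk adj x y xs \<Longrightarrow> graph_dist adj x y \<le> walk_length xs"
  unfolding graph_dist_def by (rule Least_le) blast

context connected_graph
begin

lemma exists_geodesic: "\<exists>xs. geodesic adj x y xs"
proof -
  have "\<exists>n xs. walk adj x y xs \<and> walk_length xs = n" using connected by blast
  from LeastI_ex[OF this] show ?thesis by (auto simp: geodesic_def graph_dist_def)
qed

lemma graph_dist_commute: "graph_dist adj x y = graph_dist adj y x"
proof -
  have "graph_dist adj b a \<le> graph_dist adj a b" for a b
  proof -
    obtain xs where "geodesic adj a b xs" using exists_geodesic by blast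
    then show ?thesis
      using graph_dist_le[OF walk_rev[OF adj_sym]] by (fastforce simp: geodesic_def walk_length_def)
  qed
  then show ?thesis by (simp add: order.antisym)
qed

lemma graph_dist_eq_0_iff: "graph_dist adj x y = 0 \<longleftrightarrow> x = y"
proof
  assume "graph_dist adj x y = 0"
  then obtain xs where "walk adj x y xs" "length xs - 1 = 0"
    using exists_geodesic[of x y] by (auto simp: geodesic_def walk_length_def)
  then show "x = y" by (cases xs) (auto simp: walk_def)
next
  assume "x = y"
  then have "walk adj x y [x]" by (auto simp: walk_def)
  from graph_dist_le[OF this] show "graph_dist adj x y = 0" by (simp add: walk_length_def)
qed

lemma graph_ball_half: "graph_ball adj x (1 / 2) = {x}"
proof -
  have "real (graph_dist adj x y) \<le> 1 / 2 \<longleftrightarrow> graph_dist adj x y = 0" for y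
    by linarith
  then show ?thesis by (auto simp: graph_ball_def graph_dist_eq_0_iff)
qed

lemma finite_graph_ball:
  assumes pos: "\<And>x. \<mu> x > 0" and dbl: "locally_doubling adj \<mu>"
  shows "finite (graph_ball adj x r)"
proof -
  obtain k :: nat where k: "2 * r < 2 ^ k" using real_arch_pow[of 2 "2 * r"] by auto
  obtain C where C: "C > 0" "\<And>x s. s \<in> {0<..2 ^ k} \<Longrightarrow>
      mass \<mu> (graph_ball adj x (2 * s)) \<le> ennreal C * mass \<mu> (graph_ball adj x s)"
    using dbl unfolding locally_doubling_def by (metis zero_less_numeral zero_less_power)
  have est: "j \<le> k \<Longrightarrow> mass \<mu> (graph_ball adj y (2 ^ j / 2)) \<le> ennreal (C ^ j * \<mu> y)" for j y
  proof (induction j)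
    case 0
    then show ?case by (simp add: graph_ball_half mass_def)
  next
    case (Suc j)
    have "(2::real) ^ j \<le> 2 ^ k" using Suc.prems by (intro power_increasing) auto
    then have "(2::real) ^ j / 2 \<le> 2 ^ k" using zero_less_power[of "2::real" j] by linarith
    then have "2 ^ j / 2 \<in> {0<..2 ^ k :: real}" by simp
    from C(2)[OF this, of y]
    have "mass \<mu> (graph_ball adj y (2 ^ Suc j / 2)) \<le> ennreal C * mass \<mu> (graph_ball adj y (2 ^ j / 2))"
      by simp
    also have "\<dots> \<le> ennreal C * ennreal (C ^ j * \<mu> y)"
      using Suc by (intro mult_left_mono) auto
    also have "\<dots> = ennreal (C ^ Suc j * \<mu> y)"
      using C(1) pos[of y] by (simp add: ennreal_mult' mult.assoc)
    finally show ?case .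
  qed
  let ?B = "graph_ball adj x (2 ^ k / 2)"
  define b where "b = ennreal (\<mu> x / C ^ k)"
  have "b > 0" using pos C(1) by (simp add: b_def)
  have "b \<le> ennreal (\<mu> y)" if "y \<in> ?B" for y
  proof -
    have "x \<in> graph_ball adj y (2 ^ k / 2)"
      using that graph_dist_commute[of x y] by (simp add: graph_ball_def)
    then have "mass \<mu> {x} \<le> mass \<mu> (graph_ball adj y (2 ^ k / 2))"
      unfolding mass_def by (intro infsum_mono_neutral nonneg_summable_on_complete) auto
    also have "\<dots> \<le> ennreal (C ^ k * \<mu> y)" using est by blast
    finally have "\<mu> x \<le> C ^ k * \<mu> y"
      using C(1) pos[of y] by (simp add: mass_def ennreal_le_iff)
    then show ?thesis
      using C(1) pos[of y] unfolding b_def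
      by (intro ennreal_leI) (simp add: divide_le_eq mult.commute)
  qed
  then have "infinite ?B \<Longrightarrow> mass \<mu> ?B = \<infinity>"
    unfolding mass_def using \<open>b > 0\<close> by (rule infsum_superconst_infinite_ennreal)
  moreover have "mass \<mu> ?B \<noteq> \<infinity>"
    using est[of k x] by (metis ennreal_less_top infinity_ennreal_def leD order_refl)
  ultimately have "finite ?B" by blast
  moreover have "graph_ball adj x r \<subseteq> ?B" using k by (auto simp: graph_ball_def)
  ultimately show ?thesis by (rule rev_finite_subset)
qed

lemma finite_neighbours:
  assumes "\<And>x. \<mu> x > 0" "locally_doubling adj \<mu>"
  shows "finite {y. adj x y}"
proof -
  have "graph_dist adj x y \<le> 1" if "adj x y" for y
    using graph_dist_le[of adj x y "[x, y]"] that by (simp add: walk_def walk_length_def)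
  then have "{y. adj x y} \<subseteq> graph_ball adj x 1" by (fastforce simp: graph_ball_def)
  with finite_graph_ball[OF assms] show ?thesis by (rule rev_finite_subset)
qed

end

end

theory Submission
  imports Defs
begin

text \<open>Let \<open>n\<close> be the integer part of the radius. Every vertex \<open>x\<close> of the ball is compared not with
  the centre \<open>x\<^sub>c\<close> but with the apex \<open>(p ^^ n) x\<^sub>c\<close>: traverse the standard geodesic backwards from \<open>x\<close> to
  the ascending ray of \<open>x\<^sub>c\<close>, then follow that ray up to the apex. The vertices met stay in the ball, there are
  \<open>O(n)\<close> of them, and each of them lies within distance \<open>L\<^sub>0\<close> of an ancestor of \<open>x\<close> of generation
  at most \<open>2n\<close>, because horizontal paths do not get longer under \<open>p\<close>. By the quasi-flow and the
  doubling property, the paths through a given vertex \<open>w\<close> therefore start from a set of mass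
  \<open>O(n \<mu>(w))\<close>, and Jensen's inequality along the paths gives the factor \<open>n\<^bsup>q-1\<^esup> n\<close>.\<close>

section \<open>Inequalities for finite sums\<close>

text \<open>The endpoint 0 has to be included because gradients and differences may vanish. If
  \<open>x\<close> or \<open>y\<close> is 0, convexity reduces to \<open>t powr q \<le> t\<close> on
  the unit interval.\<close>

lemma convex_on_powr:
  assumes "(q::real) \<ge> 1"
  shows "convex_on {0..} (\<lambda>x. x powr q)"
proof -
  have half: "(t * z) powr q \<le> t * z powr q" if "0 \<le> t" "t \<le> 1" "0 \<le> z" for t z :: real
  proof -
    have "t powr q \<le> t" using that assms powr_mono'[of 1 q t] by simp
    then show ?thesis using that by (simp add: powr_mult mult_right_mono)
  qed
  show ?thesis
  proof (rule convex_onI)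
    fix t x y :: real
    assume t: "0 < t" "t < 1" and xy: "x \<in> {0..}" "y \<in> {0..}"
    show "((1 - t) *\<^sub>R x + t *\<^sub>R y) powr q \<le> (1 - t) * x powr q + t * y powr q"
    proof (cases "x = 0 \<or> y = 0")
      case True
      then show ?thesis using half[of t y] half[of "1 - t" x] t xy assms by auto
    next
      case False
      then have "x \<in> {0<..}" "y \<in> {0<..}" using xy by auto
      then show ?thesis using convex_onD[OF powr_convex[OF assms], of t x y] t by simp
    qed
  qed auto
qed

text \<open>Jensen's inequality for the normalised weights \<open>a i / A\<close>, multiplied by
  \<open>A powr q\<close>. Unit weights give the estimate along a path, the weights
  \<open>\<mu>\<close> the one for averages.\<close>

lemma powr_weighted_sum_le:
  fixes a y :: "'b \<Rightarrow> real"
  assumes q: "(q::real) \<ge> 1" and fin: "finite S"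
    and a: "\<And>i. i \<in> S \<Longrightarrow> a i \<ge> 0" and y: "\<And>i. i \<in> S \<Longrightarrow> y i \<ge> 0"
  shows "(\<Sum>i\<in>S. a i * y i) powr q \<le> (\<Sum>i\<in>S. a i) powr (q - 1) * (\<Sum>i\<in>S. a i * y i powr q)"
proof (cases "(\<Sum>i\<in>S. a i) = 0")
  case True
  then have "\<And>i. i \<in> S \<Longrightarrow> a i = 0" using fin a by (simp add: sum_nonneg_eq_0_iff)
  then show ?thesis using q by simp
next
  case False
  define A where "A = (\<Sum>i\<in>S. a i)"
  have A: "A > 0" using False a unfolding A_def by (simp add: sum_nonneg order.not_eq_order_implies_strict)
  have "(\<Sum>i\<in>S. (a i / A) *\<^sub>R y i) powr q \<le> (\<Sum>i\<in>S. (a i / A) * y i powr q)"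
  proof (rule convex_on_sum[OF fin _ convex_on_powr[OF q]])
    show "S \<noteq> {}" using False by auto
    show "(\<Sum>i\<in>S. a i / A) = 1" using A by (simp add: A_def flip: sum_divide_distrib)
  qed (use a y A in auto)
  then have "((\<Sum>i\<in>S. a i * y i) / A) powr q \<le> (\<Sum>i\<in>S. a i * y i powr q) / A"
    by (simp add: sum_divide_distrib)
  moreover have "(\<Sum>i\<in>S. a i * y i) \<ge> 0" using a y by (simp add: sum_nonneg)
  ultimately have "(\<Sum>i\<in>S. a i * y i) powr q / A powr q \<le> (\<Sum>i\<in>S. a i * y i powr q) / A"
    using A by (simp add: powr_divide)
  then have "(\<Sum>i\<in>S. a i * y i) powr q \<le> A powr q / A * (\<Sum>i\<in>S. a i * y i powr q)"
    using A by (simp add: field_simps)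
  also have "A powr q / A = A powr (q - 1)" using A by (simp add: powr_diff)
  finally show ?thesis by (simp add: A_def)
qed

lemma powr_add_le:
  fixes s t :: real
  assumes "q \<ge> 1" "s \<ge> 0" "t \<ge> 0"
  shows "(s + t) powr q \<le> 2 powr (q - 1) * (s powr q + t powr q)"
  using powr_weighted_sum_le[of q "{True, False}" "\<lambda>_. 1" "\<lambda>b. if b then s else t"] assms by simp

text \<open>Allows the average to be replaced by any convenient constant \<open>c\<close>, later the
  value of \<open>f\<close> at the apex. Jensen bounds the distance from \<open>c\<close> to the
  average by the mean deviation from \<open>c\<close>, and the triangle inequality does the
  rest.\<close>

lemma sum_dist_average_powr_le:
  fixes f :: "'b \<Rightarrow> complex" and \<mu> :: "'b \<Rightarrow> real"
  assumes q: "q \<ge> 1" and fin: "finite B" and ne: "B \<noteq> {}" and pos: "\<And>x. x \<in> B \<Longrightarrow> \<mu> x > 0"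
  shows "(\<Sum>x\<in>B. cmod (f x - (\<Sum>y\<in>B. f y * of_real (\<mu> y)) / of_real (\<Sum>y\<in>B. \<mu> y)) powr q * \<mu> x)
    \<le> 2 powr q * (\<Sum>x\<in>B. cmod (f x - c) powr q * \<mu> x)"
proof -
  define M where "M = (\<Sum>y\<in>B. \<mu> y)"
  define m where "m = (\<Sum>y\<in>B. f y * of_real (\<mu> y)) / of_real M"
  define I where "I = (\<Sum>x\<in>B. cmod (f x - c) powr q * \<mu> x)"
  have M: "M > 0" unfolding M_def using fin ne pos by (rule sum_pos)
  \<comment> \<open>The weights \<open>\<mu> y / M\<close> add up to 1, so the constant
    \<open>c\<close> is its own average.\<close>
  have "c - m = (\<Sum>y\<in>B. (c - f y) * of_real (\<mu> y)) / of_real M"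
    using M by (simp add: m_def M_def sum_subtractf left_diff_distrib diff_divide_distrib
        flip: sum_distrib_left of_real_sum)
  then have "cmod (c - m) = cmod (\<Sum>y\<in>B. (c - f y) * of_real (\<mu> y)) / M"
    using M by (simp add: norm_divide)
  also have "\<dots> \<le> (\<Sum>y\<in>B. \<mu> y * cmod (f y - c)) / M"
  proof (intro divide_right_mono order.trans[OF norm_sum] sum_mono)
    show "cmod ((c - f y) * of_real (\<mu> y)) \<le> \<mu> y * cmod (f y - c)" if "y \<in> B" for y
      using pos[OF that] by (simp add: norm_mult norm_minus_commute)
  qed (use M in simp)
  finally have "cmod (c - m) powr q \<le> ((\<Sum>y\<in>B. \<mu> y * cmod (f y - c)) / M) powr q"
    using q by (intro powr_mono2) auto
  also have "\<dots> = (\<Sum>y\<in>B. \<mu> y * cmod (f y - c)) powr q / M powr q"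
    using M pos by (simp add: powr_divide sum_nonneg less_imp_le)
  also have "\<dots> \<le> (M powr (q - 1) * I) / M powr q"
    using powr_weighted_sum_le[OF q fin, of \<mu> "\<lambda>y. cmod (f y - c)"] pos
    by (intro divide_right_mono) (auto simp: M_def I_def mult.commute less_imp_le)
  also have "\<dots> = I / M" using M by (simp add: powr_diff)
  finally have avg: "cmod (c - m) powr q * M \<le> I" using M by (simp add: field_simps)
  have "(\<Sum>x\<in>B. cmod (f x - m) powr q * \<mu> x)
    \<le> (\<Sum>x\<in>B. 2 powr (q - 1) * (cmod (f x - c) powr q + cmod (c - m) powr q) * \<mu> x)"
  proof (intro sum_mono mult_right_mono)
    fix x assume "x \<in> B"
    have "cmod (f x - m) \<le> cmod (f x - c) + cmod (c - m)"
      using norm_triangle_ineq[of "f x - c" "c - m"] by simp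
    then have "cmod (f x - m) powr q \<le> (cmod (f x - c) + cmod (c - m)) powr q"
      using q by (intro powr_mono2) auto
    also have "\<dots> \<le> 2 powr (q - 1) * (cmod (f x - c) powr q + cmod (c - m) powr q)"
      using q by (intro powr_add_le) auto
    finally show "cmod (f x - m) powr q \<le> 2 powr (q - 1) * (cmod (f x - c) powr q + cmod (c - m) powr q)" .
  qed (use pos in \<open>auto simp: less_imp_le\<close>)
  also have "\<dots> = 2 powr (q - 1) * (I + cmod (c - m) powr q * M)"
    by (simp add: I_def M_def sum_distrib_left sum_distrib_right sum.distrib algebra_simps)
  also have "\<dots> \<le> 2 powr (q - 1) * (I + I)" using avg by (intro mult_left_mono) auto
  also have "\<dots> = 2 powr q * I" by (simp add: powr_diff)
  finally show ?thesis by (simp add: I_def m_def M_def)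
qed

text \<open>Union bound: the disjoint sum of the \<open>T i\<close> projects onto their union, and
  overlaps only increase the right side since \<open>g\<close> is nonnegative.\<close>

lemma sum_le_sum_UN:
  fixes g :: "'b \<Rightarrow> real"
  assumes fin: "finite I" "\<And>i. i \<in> I \<Longrightarrow> finite (T i)"
    and A: "A \<subseteq> (\<Union>i\<in>I. T i)" and g: "\<And>x. g x \<ge> 0"
  shows "(\<Sum>x\<in>A. g x) \<le> (\<Sum>i\<in>I. \<Sum>x\<in>T i. g x)"
proof -
  have "(\<Sum>x\<in>A. g x) \<le> (\<Sum>x\<in>snd ` (SIGMA i:I. T i). g x)"
    using fin g A by (intro sum_mono2) (auto simp: image_def)
  also have "\<dots> \<le> (\<Sum>z\<in>(SIGMA i:I. T i). g (snd z))"
    using sum_image_le[of "SIGMA i:I. T i" g snd] fin g by (simp add: comp_def)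
  also have "\<dots> = (\<Sum>i\<in>I. \<Sum>x\<in>T i. g x)"
    using fin by (subst sum.Sigma) (auto simp: case_prod_beta)
  finally show ?thesis .
qed

section \<open>Walks and distance\<close>

lemma walk_append:
  assumes "walk adj x y xs" "walk adj y z ys"
  shows "walk adj x z (xs @ tl ys)"
proof (cases ys)
  case (Cons a zs)
  then show ?thesis using assms
    by (cases "zs = []") (auto simp: walk_def successively_append_iff successively_Cons)
qed (use assms in \<open>simp add: walk_def\<close>)

lemma walk_split:
  assumes "walk adj x y (us @ v # vs)"
  shows "walk adj x v (us @ [v])" "walk adj v y (v # vs)"
  using assms by (auto simp: walk_def successively_append_iff hd_append)

context connected_graph
begin

lemma graph_dist_triangle: "graph_dist adj x z \<le> graph_dist adj x y + graph_dist adj y z"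
proof -
  obtain xs ys where "geodesic adj x y xs" "geodesic adj y z ys" using exists_geodesic by metis
  then have w: "walk adj x y xs" "walk adj y z ys"
    and l: "walk_length xs = graph_dist adj x y" "walk_length ys = graph_dist adj y z"
    by (auto simp: geodesic_def)
  have "xs \<noteq> []" using w by (simp add: walk_def)
  then have "walk_length (xs @ tl ys) = walk_length xs + walk_length ys"
    by (cases xs) (auto simp: walk_length_def)
  then show ?thesis using graph_dist_le[OF walk_append[OF w]] l by simp
qed

lemma graph_dist_walk_start:
  assumes "walk adj x y xs" "v \<in> set xs"
  shows "graph_dist adj x v \<le> walk_length xs"
proof -
  obtain us vs where xs: "xs = us @ v # vs" using assms(2) split_list by metis
  with graph_dist_le[OF walk_split(1)] assms(1) have "graph_dist adj x v \<le> walk_length (us @ [v])"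
    by metis
  then show ?thesis by (simp add: xs walk_length_def)
qed

text \<open>Steps may stand still, because \<open>p\<close> can merge the ends of a horizontal edge;
  the number of steps then still bounds the distance.\<close>

lemma graph_dist_relpowp:
  assumes "((\<lambda>u v. u = v \<or> adj u v) ^^ l) x y"
  shows "graph_dist adj x y \<le> l"
  using assms
proof (induction l arbitrary: y)
  case 0
  then show ?case by (simp add: graph_dist_eq_0_iff)
next
  case (Suc l)
  then obtain w where w: "((\<lambda>u v. u = v \<or> adj u v) ^^ l) x w" "w = y \<or> adj w y" by auto
  have "graph_dist adj w y \<le> 1" 
    using w(2) graph_dist_le[of adj w y "[w, y]"] graph_dist_eq_0_iff[of w y]
    by (auto simp: walk_def walk_length_def)
  then show ?case using Suc.IH[OF w(1)] graph_dist_triangle[of x y w] by simp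
qed

text \<open>The sum runs over a set, so a vertex visited repeatedly contributes once. Therefore the
  induction is on the length of the walk: if the first vertex recurs, the loop is cut out, otherwise
  the first edge is charged to the gradient at \<open>x\<close>.\<close>

lemma cmod_diff_le_sum_grad_norm:
  assumes "walk adj x y xs" and fin: "\<And>x. finite {y. adj x y}"
  shows "cmod (f x - f y) \<le> (\<Sum>v\<in>set xs. grad_norm adj f v)"
  using assms(1)
proof (induction xs arbitrary: x rule: length_induct)
  case (1 xs)
  have nonneg: "grad_norm adj f v \<ge> 0" for v by (simp add: grad_norm_def sum_nonneg)
  obtain zs where xs: "xs = x # zs" using 1(2) by (cases xs) (auto simp: walk_def)
  show ?case
  proof (cases "x \<in> set zs")
    case True
    then obtain us vs where zs: "zs = us @ x # vs" using split_list by metis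
    have "walk adj x y (x # vs)" using 1(2) walk_split(2)[of adj x y "x # us" x vs] by (simp add: xs zs)
    then have "cmod (f x - f y) \<le> (\<Sum>v\<in>set (x # vs). grad_norm adj f v)"
      using 1(1)[rule_format, of "x # vs" x] by (simp add: xs zs)
    also have "\<dots> \<le> (\<Sum>v\<in>set xs. grad_norm adj f v)"
      using nonneg by (intro sum_mono2) (auto simp: xs zs)
    finally show ?thesis .
  next
    case False
    show ?thesis
    proof (cases zs)
      case Nil
      then show ?thesis using 1(2) nonneg by (simp add: xs walk_def)
    next
      case (Cons z ws)
      have adj: "adj x z" and w: "walk adj z y zs" using 1(2) by (auto simp: xs Cons walk_def)
      have "cmod (f x - f z) \<le> grad_norm adj f x"
        unfolding grad_norm_def using adj fin[of x] by (intro member_le_sum) auto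
      moreover have "cmod (f z - f y) \<le> (\<Sum>v\<in>set zs. grad_norm adj f v)"
        using 1(1) w by (simp add: xs)
      moreover have "cmod (f x - f y) \<le> cmod (f x - f z) + cmod (f z - f y)"
        using norm_triangle_ineq[of "f x - f z" "f z - f y"] by simp
      ultimately show ?thesis using False by (simp add: xs)
    qed
  qed
qed

text \<open>A ball of radius 1/2 is a single vertex, so boundedly many doublings from there compare
  a ball of fixed radius with its centre, uniformly in the centre.\<close>

lemma ball_sum_le_of_locally_doubling:
  assumes pos: "\<And>x. \<mu> x > 0" and dbl: "locally_doubling adj \<mu>"
  shows "\<exists>D\<ge>0. \<forall>x. (\<Sum>y\<in>graph_ball adj x R. \<mu> y) \<le> D * \<mu> x"
proof -
  \<comment> \<open>After \<open>k\<close> doublings the radius 1/2 has grown to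
    \<open>2 ^ k / 2\<close>, which exceeds \<open>R\<close>.\<close>
  obtain k :: nat where k: "2 * R < 2 ^ k" using real_arch_pow[of 2 "2 * R"] by auto
  obtain C where C: "C > 0" "\<And>x s. s \<in> {0<..2 ^ k} \<Longrightarrow>
      mass \<mu> (graph_ball adj x (2 * s)) \<le> ennreal C * mass \<mu> (graph_ball adj x s)"
    using dbl unfolding locally_doubling_def by (metis zero_less_numeral zero_less_power)
  have fin: "finite (graph_ball adj x s)" for x s by (rule finite_graph_ball[OF pos dbl])
  have dbl_sum: "(\<Sum>y\<in>graph_ball adj x (2 * s). \<mu> y) \<le> C * (\<Sum>y\<in>graph_ball adj x s. \<mu> y)"
    if "0 < s" "s \<le> 2 ^ k" for x s
  proof -
    have "ennreal (\<Sum>y\<in>graph_ball adj x (2 * s). \<mu> y) \<le> ennreal (C * (\<Sum>y\<in>graph_ball adj x s. \<mu> y))"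
      using C(2)[of s x] C(1) that fin pos
      by (simp add: mass_def sum_ennreal ennreal_mult' less_imp_le)
    then show ?thesis using C(1) pos by (simp add: ennreal_le_iff sum_nonneg less_imp_le)
  qed
  have est: "j \<le> k \<Longrightarrow> (\<Sum>y\<in>graph_ball adj x (2 ^ j / 2). \<mu> y) \<le> C ^ j * \<mu> x" for j x
  proof (induction j)
    case 0
    then show ?case by (simp add: graph_ball_half)
  next
    case (Suc j)
    have "(2::real) ^ j \<le> 2 ^ k" using Suc.prems by (intro power_increasing) auto
    then have "(2::real) ^ j / 2 \<le> 2 ^ k" using zero_less_power[of "2::real" j] by linarith
    then have "(\<Sum>y\<in>graph_ball adj x (2 ^ Suc j / 2). \<mu> y) \<le> C * (\<Sum>y\<in>graph_ball adj x (2 ^ j / 2). \<mu> y)"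
      using dbl_sum[of "2 ^ j / 2" x] by simp
    also have "\<dots> \<le> C * (C ^ j * \<mu> x)" using Suc C(1) by (intro mult_left_mono) auto
    finally show ?case by (simp add: mult.assoc)
  qed
  have "(\<Sum>y\<in>graph_ball adj x R. \<mu> y) \<le> C ^ k * \<mu> x" for x
  proof -
    have "(\<Sum>y\<in>graph_ball adj x R. \<mu> y) \<le> (\<Sum>y\<in>graph_ball adj x (2 ^ k / 2). \<mu> y)"
      using pos k by (intro sum_mono2[OF fin]) (auto simp: graph_ball_def less_imp_le)
    then show ?thesis using est[of k x] by simp
  qed
  then show ?thesis using C(1) by (intro exI[of _ "C ^ k"]) auto
qed

end

section \<open>Paths to the apex\<close>

lemma descendants_eq: "descendants p m x = {z. (p ^^ m) z = x}"
  by (induction m arbitrary: x) (auto simp: funpow_swap1)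

lemma quasi_flow_sum_le:
  assumes flow: "\<And>n x. mass \<mu> (descendants p n x) \<le> ennreal (C * \<mu> x)"
    and pos: "\<And>x. \<mu> x > 0" and C: "C \<ge> 0" and A: "finite A" "A \<subseteq> {z. (p ^^ m) z = x}"
  shows "(\<Sum>z\<in>A. \<mu> z) \<le> C * \<mu> x"
proof -
  have "mass \<mu> A \<le> mass \<mu> (descendants p m x)"
    unfolding mass_def using A
    by (intro infsum_mono_neutral nonneg_summable_on_complete) (auto simp: descendants_eq)
  also have "\<dots> \<le> ennreal (C * \<mu> x)" by (rule flow)
  finally have "ennreal (\<Sum>z\<in>A. \<mu> z) \<le> ennreal (C * \<mu> x)"
    using A pos by (simp add: mass_def sum_ennreal less_imp_le)
  then show ?thesis using C pos[of x] by (simp add: ennreal_le_iff)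
qed

context spiderweb
begin

lemma walk_ascending: "walk adj x ((p ^^ m) x) (map (\<lambda>i. (p ^^ i) x) [0..<Suc m])"
proof (induction m)
  case 0
  then show ?case by (simp add: walk_def)
next
  case (Suc m)
  have "walk adj ((p ^^ m) x) ((p ^^ Suc m) x) [(p ^^ m) x, (p ^^ Suc m) x]"
    using adj_pred by (simp add: walk_def)
  from walk_append[OF Suc this] show ?case by simp
qed

lemma horizontal_if_same_height: "adj u v \<Longrightarrow> h u = h v \<Longrightarrow> horizontal adj p u v"
  using height_pred by (auto simp: horizontal_def vertical_def)

text \<open>By the third spiderweb axiom \<open>p\<close> sends a horizontal edge to a horizontal
  edge or to one vertex. As standing still is allowed, the number \<open>l\<close> of steps is
  preserved.\<close>

lemma horizontal_relpowp_pred: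
  assumes "((\<lambda>u v. u = v \<or> horizontal adj p u v) ^^ l) x y"
  shows "((\<lambda>u v. u = v \<or> horizontal adj p u v) ^^ l) ((p ^^ m) x) ((p ^^ m) y)"
proof -
  have step: "((\<lambda>u v. u = v \<or> horizontal adj p u v) ^^ l) (p a) (p b)"
    if "((\<lambda>u v. u = v \<or> horizontal adj p u v) ^^ l) a b" for a b l
    using that
  proof (induction l arbitrary: b)
    case (Suc l)
    then obtain w where "((\<lambda>u v. u = v \<or> horizontal adj p u v) ^^ l) a w"
      "w = b \<or> horizontal adj p w b" by auto
    then have "((\<lambda>u v. u = v \<or> horizontal adj p u v) ^^ l) (p a) (p w)"
      "p w = p b \<or> horizontal adj p (p w) (p b)" using Suc.IH horizontal_pred by auto
    then show ?case by (auto intro: relcomppI)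
  qed simp
  show ?thesis by (induction m) (use assms step in auto)
qed

lemma horizontal_walk_relpowp:
  assumes "horizontal_walk adj h k x y zs"
  shows "((\<lambda>u v. u = v \<or> horizontal adj p u v) ^^ walk_length zs) x y"
  using assms
proof (induction zs arbitrary: x)
  case Nil
  then show ?case by (simp add: horizontal_walk_def walk_def)
next
  case (Cons a zs)
  then have a: "a = x" by (simp add: horizontal_walk_def walk_def)
  show ?case
  proof (cases zs)
    case Nil
    then show ?thesis using Cons.prems by (auto simp: horizontal_walk_def walk_def walk_length_def)
  next
    case (Cons b ws)
    have "horizontal_walk adj h k b y zs" "horizontal adj p x b"
      using Cons.prems horizontal_if_same_height
      by (auto simp: Cons a horizontal_walk_def walk_def)
    then have "((\<lambda>u v. u = v \<or> horizontal adj p u v) ^^ Suc (walk_length zs)) x y"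
      using Cons.IH by (intro relpowp_Suc_I2[where y = b]) auto
    then show ?thesis by (simp add: Cons walk_length_def)
  qed
qed

lemma graph_dist_horizontal_pred:
  assumes "horizontal_walk adj h k x y zs"
  shows "graph_dist adj ((p ^^ m) x) ((p ^^ m) y) \<le> walk_length zs"
proof (rule graph_dist_relpowp)
  have "(\<lambda>u v. u = v \<or> horizontal adj p u v) \<le> (\<lambda>u v. u = v \<or> adj u v)"
    by (auto simp: horizontal_def)
  with horizontal_relpowp_pred[OF horizontal_walk_relpowp[OF assms], of m]
  show "((\<lambda>u v. u = v \<or> adj u v) ^^ walk_length zs) ((p ^^ m) x) ((p ^^ m) y)"
    using relpowp_mono by (smt (verit) predicate2D)
qed

text \<open>The walk has three pieces: \<open>b\<close> steps up from \<open>x\<close>, the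
  horizontal component reversed, and \<open>n - a\<close> further steps up the ray of
  \<open>c\<close>. The last conclusion makes it possible to count the starting points
  \<open>x\<close> of the walks through a given \<open>w\<close>.\<close>

lemma walk_to_apex:
  assumes geo: "standard_geodesic adj h p c x zs xs" and L: "walk_length zs \<le> L"
    and n: "graph_dist adj c x \<le> n"
  obtains ys where "walk adj x ((p ^^ n) c) ys" "length ys \<le> 2 * n + L + 1"
    "\<And>w. w \<in> set ys \<Longrightarrow> graph_dist adj c w \<le> n"
    "\<And>w. w \<in> set ys \<Longrightarrow> \<exists>m\<le>2 * n. graph_dist adj w ((p ^^ m) x) \<le> L"
proof -
  obtain k where k: "k \<ge> h c" "k \<ge> h x" and G: "in_Gamma adj h p c x k zs xs"
    and xs: "walk adj c x xs" "walk_length xs = graph_dist adj c x"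
    using geo by (auto simp: standard_geodesic_def geodesic_def)
  \<comment> \<open>The numbers of vertical steps of the geodesic on the side of \<open>c\<close>
    and on the side of \<open>x\<close>.\<close>
  define a b where "a = nat (k - h c)" and "b = nat (k - h x)"
  define as bs where "as = map (\<lambda>i. (p ^^ i) c) [0..<a]" and "bs = map (\<lambda>i. (p ^^ i) x) [0..<b]"
  have hw: "horizontal_walk adj h k ((p ^^ a) c) ((p ^^ b) x) zs" and xs_eq: "xs = as @ zs @ rev bs"
    using G by (auto simp: in_Gamma_def a_def b_def ascent_def as_def bs_def)
  have zs: "walk adj ((p ^^ a) c) ((p ^^ b) x) zs" "zs \<noteq> []"
    using hw by (auto simp: horizontal_walk_def walk_def)
  have len: "a + b + walk_length zs \<le> n"
    using n xs(2) zs(2) by (cases zs) (auto simp: xs_eq as_def bs_def walk_length_def)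
  \<comment> \<open>By \<open>len\<close>, \<open>a \<le> n\<close>, so the subtraction is not
    truncated and \<open>vs\<close> ends at the apex.\<close>
  define vs where "vs = map (\<lambda>i. (p ^^ i) ((p ^^ a) c)) [0..<Suc (n - a)]"
  have vs: "walk adj ((p ^^ a) c) ((p ^^ n) c) vs"
    using walk_ascending[of "(p ^^ a) c" "n - a"] len
    by (simp add: vs_def flip: comp_apply[of "p ^^ (n - a)"] funpow_add del: upt_Suc)
  define ys where "ys = (map (\<lambda>i. (p ^^ i) x) [0..<Suc b] @ tl (rev zs)) @ tl vs"
  show thesis
  proof (rule that)
    show "walk adj x ((p ^^ n) c) ys"
      unfolding ys_def
      by (intro walk_append[OF walk_append[OF walk_ascending walk_rev[OF adj_sym zs(1)]] vs])
    show "length ys \<le> 2 * n + L + 1"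
      using len L zs(2) by (auto simp: ys_def vs_def walk_length_def)
    fix w assume "w \<in> set ys"
    \<comment> \<open>\<open>bs\<close> stops just below the top vertex \<open>(p ^^ b) x\<close>,
      which is an end of \<open>zs\<close> and is treated with the horizontal vertices.\<close>
    moreover have "set (map (\<lambda>i. (p ^^ i) x) [0..<Suc b]) = insert ((p ^^ b) x) (set bs)"
      by (auto simp: bs_def)
    moreover have "set (tl (rev zs)) \<subseteq> set zs" "set (tl vs) \<subseteq> set vs"
      using list.set_sel(2)[of "rev zs"] list.set_sel(2)[of vs] by (cases "vs = []"; use zs(2) in auto)+
    ultimately have "w \<in> set bs \<or> w = (p ^^ b) x \<or> w \<in> set zs \<or> w \<in> set vs"
      unfolding ys_def set_append by blast
    moreover have "(p ^^ b) x \<in> set zs" using zs last_in_set[of zs] by (simp add: walk_def)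
    ultimately consider (desc) "w \<in> set bs" | (hor) "w \<in> set zs" | (asc) "w \<in> set vs" by blast
    then have "graph_dist adj c w \<le> n \<and> (\<exists>m\<le>2 * n. graph_dist adj w ((p ^^ m) x) \<le> L)"
    proof cases
      case desc
      then obtain i where "w = (p ^^ i) x" "i \<le> 2 * n" using len by (auto simp: bs_def)
      moreover have "graph_dist adj w w = 0" by (simp add: graph_dist_eq_0_iff)
      moreover have "w \<in> set xs" using desc by (simp add: xs_eq)
      ultimately show ?thesis using graph_dist_walk_start[OF xs(1)] xs(2) n
        by (metis le0 order.trans)
    next
      case hor
      have "graph_dist adj ((p ^^ b) x) w \<le> walk_length (rev zs)"
        using hor by (intro graph_dist_walk_start[OF walk_rev[OF adj_sym zs(1)]]) auto
      then have "graph_dist adj w ((p ^^ b) x) \<le> L"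
        using L by (simp add: walk_length_def graph_dist_commute[of w])
      moreover have "w \<in> set xs" using hor by (simp add: xs_eq)
      then have "graph_dist adj c w \<le> n" using graph_dist_walk_start[OF xs(1)] xs(2) n by force
      ultimately show ?thesis using len by (intro conjI exI[of _ b]) auto
    next
      case asc
      then obtain i where i: "w = (p ^^ i) ((p ^^ a) c)" "i \<le> n - a"
        by (auto simp: vs_def simp del: upt_Suc)
      have "graph_dist adj c w \<le> i + a"
        using graph_dist_le[OF walk_ascending[of c "i + a"]] i
        by (simp add: walk_length_def funpow_add)
      \<comment> \<open>\<open>w\<close> and \<open>(p ^^ (i + b)) x\<close> are the images under
        \<open>p ^^ i\<close> of the two ends of \<open>zs\<close>, hence no farther apart than
        \<open>walk_length zs\<close>. The generation \<open>i + b\<close> is at most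
        \<open>2 * n\<close> since \<open>i\<close> and \<open>b\<close> are both at most
        \<open>n\<close>.\<close>
      moreover have "graph_dist adj w ((p ^^ (i + b)) x) \<le> L"
        using graph_dist_horizontal_pred[OF hw, of i] L i by (simp add: funpow_add)
      ultimately show ?thesis using i len by (intro conjI exI[of _ "i + b"]) auto
    qed
    then show "graph_dist adj c w \<le> n" "\<exists>m\<le>2 * n. graph_dist adj w ((p ^^ m) x) \<le> L" by auto
  qed
qed

section \<open>Overlap of the walks and the estimate around the apex\<close>

text \<open>\<open>A\<close> is covered by the fibres of \<open>p ^^ m\<close> over the vertices
  \<open>y\<close> of the ball around \<open>w\<close>, for the \<open>N + 1\<close> generations
  \<open>m\<close>. The quasi-flow bounds each fibre by \<open>C * \<mu> y\<close>, and
  \<open>D\<close> controls the sum over the ball.\<close>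

lemma sum_near_ancestor_le:
  assumes flow: "\<And>n x. mass \<mu> (descendants p n x) \<le> ennreal (C * \<mu> x)"
    and pos: "\<And>x. \<mu> x > 0" and C: "C \<ge> 0"
    and dbl: "locally_doubling adj \<mu>" and D: "(\<Sum>y\<in>graph_ball adj w (real L). \<mu> y) \<le> D * \<mu> w"
    and A: "finite A" "\<And>x. x \<in> A \<Longrightarrow> \<exists>m\<le>N. graph_dist adj w ((p ^^ m) x) \<le> L"
  shows "(\<Sum>x\<in>A. \<mu> x) \<le> real (N + 1) * (C * D) * \<mu> w"
proof -
  let ?B = "graph_ball adj w (real L)"
  let ?T = "\<lambda>m y. {x\<in>A. (p ^^ m) x = y}"
  have finB: "finite ?B" by (rule finite_graph_ball[OF pos dbl])
  have "(\<Sum>x\<in>A. \<mu> x) \<le> (\<Sum>m\<in>{..N}. \<Sum>x\<in>(\<Union>y\<in>?B. ?T m y). \<mu> x)"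
  proof (rule sum_le_sum_UN)
    show "A \<subseteq> (\<Union>m\<in>{..N}. \<Union>y\<in>?B. ?T m y)"
    proof
      fix x assume "x \<in> A"
      moreover from A(2)[OF this] obtain m where "m \<le> N" "(p ^^ m) x \<in> ?B"
        by (auto simp: graph_ball_def)
      ultimately show "x \<in> (\<Union>m\<in>{..N}. \<Union>y\<in>?B. ?T m y)" by auto
    qed
  qed (use A(1) finB pos in \<open>auto simp: less_imp_le\<close>)
  also have "\<dots> \<le> (\<Sum>m\<in>{..N}. \<Sum>y\<in>?B. \<Sum>x\<in>?T m y. \<mu> x)"
    using A(1) finB pos by (intro sum_mono sum_le_sum_UN) (auto simp: less_imp_le)
  also have "\<dots> \<le> (\<Sum>m\<in>{..N}. \<Sum>y\<in>?B. C * \<mu> y)"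
    using A(1) by (intro sum_mono quasi_flow_sum_le[OF flow pos C]) auto
  also have "\<dots> = real (N + 1) * (C * (\<Sum>y\<in>?B. \<mu> y))"
    by (simp add: sum_distrib_left)
  also have "\<dots> \<le> real (N + 1) * (C * (D * \<mu> w))"
    using D C by (intro mult_left_mono) auto
  finally show ?thesis by (simp add: mult.assoc)
qed

text \<open>The radius is a positive integer, so additive constants are absorbed into multiples of
  \<open>n\<close>. The resulting constant depends only on \<open>L\<close>, \<open>C\<close>,
  \<open>D\<close> and \<open>q\<close>.\<close>

lemma poincare_apex:
  fixes f :: "'a \<Rightarrow> complex"
  assumes geo: "\<And>x y. \<exists>zs xs. standard_geodesic adj h p x y zs xs \<and> walk_length zs \<le> L"
    and flow: "\<And>n x. mass \<mu> (descendants p n x) \<le> ennreal (C * \<mu> x)"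
    and pos: "\<And>x. \<mu> x > 0" and C: "C \<ge> 0"
    and dbl: "locally_doubling adj \<mu>" and D: "D \<ge> 0" "\<And>x. (\<Sum>y\<in>graph_ball adj x (real L). \<mu> y) \<le> D * \<mu> x"
    and q: "q \<ge> 1" and n: "n \<ge> 1"
  shows "(\<Sum>x\<in>graph_ball adj c (real n). cmod (f x - f ((p ^^ n) c)) powr q * \<mu> x)
    \<le> real (L + 3) powr (q - 1) * (3 * (C * D)) * real n powr q *
      (\<Sum>x\<in>graph_ball adj c (real n). grad_norm adj f x powr q * \<mu> x)"
proof -
  define B where "B = graph_ball adj c (real n)"
  define g where "g = grad_norm adj f"
  define K where "K = (real (L + 3) * real n) powr (q - 1)"
  have g: "g x \<ge> 0" for x by (simp add: g_def grad_norm_def sum_nonneg)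
  have finB: "finite B" unfolding B_def by (rule finite_graph_ball[OF pos dbl])
  \<comment> \<open>\<open>S\<close> is the vertex set of the walk from \<open>x\<close> to the
    apex. It lies in \<open>B\<close>, so the gradient is summed over the same ball, without
    enlarging it.\<close>
  have "\<exists>S. S \<subseteq> B \<and> card S \<le> (L + 3) * n \<and> cmod (f x - f ((p ^^ n) c)) \<le> (\<Sum>w\<in>S. g w) \<and>
      (\<forall>w\<in>S. \<exists>m\<le>2 * n. graph_dist adj w ((p ^^ m) x) \<le> L)" if "x \<in> B" for x
  proof -
    obtain zs xs where "standard_geodesic adj h p c x zs xs" "walk_length zs \<le> L" using geo by blast
    moreover have "graph_dist adj c x \<le> n" using that by (simp add: B_def graph_ball_def)
    ultimately obtain ys where ys: "walk adj x ((p ^^ n) c) ys" "length ys \<le> 2 * n + L + 1"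
      "\<And>w. w \<in> set ys \<Longrightarrow> graph_dist adj c w \<le> n"
      "\<And>w. w \<in> set ys \<Longrightarrow> \<exists>m\<le>2 * n. graph_dist adj w ((p ^^ m) x) \<le> L"
      by (rule walk_to_apex) blast
    have "2 * n + L + 1 \<le> (L + 3) * n"
    proof -
      have "L * 1 \<le> L * n" using n by (intro mult_left_mono) auto
      moreover have "(L + 3) * n = L * n + 3 * n" by (simp add: algebra_simps)
      ultimately show ?thesis using n by linarith
    qed
    then have "card (set ys) \<le> (L + 3) * n" using ys(2) card_length[of ys] by linarith
    moreover have "set ys \<subseteq> B" using ys(3) by (auto simp: B_def graph_ball_def)
    ultimately show ?thesis
      using ys(4) cmod_diff_le_sum_grad_norm[OF ys(1) finite_neighbours[OF pos dbl], of f]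
      by (intro exI[of _ "set ys"]) (auto simp: g_def)
  qed
  then obtain S where S: "\<And>x. x \<in> B \<Longrightarrow> S x \<subseteq> B" "\<And>x. x \<in> B \<Longrightarrow> card (S x) \<le> (L + 3) * n"
    "\<And>x. x \<in> B \<Longrightarrow> cmod (f x - f ((p ^^ n) c)) \<le> (\<Sum>w\<in>S x. g w)"
    "\<And>x w. x \<in> B \<Longrightarrow> w \<in> S x \<Longrightarrow> \<exists>m\<le>2 * n. graph_dist adj w ((p ^^ m) x) \<le> L"
    by metis
  have pointwise: "cmod (f x - f ((p ^^ n) c)) powr q \<le> K * (\<Sum>w\<in>S x. g w powr q)" if "x \<in> B" for x
  proof -
    have fin: "finite (S x)" using S(1)[OF that] finB by (rule finite_subset)
    have "cmod (f x - f ((p ^^ n) c)) powr q \<le> (\<Sum>w\<in>S x. g w) powr q"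
      using S(3)[OF that] q by (intro powr_mono2) auto
    also have "\<dots> \<le> real (card (S x)) powr (q - 1) * (\<Sum>w\<in>S x. g w powr q)"
      using powr_weighted_sum_le[OF q fin, of "\<lambda>_. 1" g] g by simp
    also have "\<dots> \<le> K * (\<Sum>w\<in>S x. g w powr q)"
    proof (rule mult_right_mono)
      have "real (card (S x)) \<le> real (L + 3) * real n"
        using S(2)[OF that] by (simp only: flip: of_nat_mult of_nat_le_iff)
      then show "real (card (S x)) powr (q - 1) \<le> K"
        unfolding K_def using q by (intro powr_mono2) auto
    qed (simp add: sum_nonneg)
    finally show ?thesis .
  qed
  have "(\<Sum>x\<in>B. cmod (f x - f ((p ^^ n) c)) powr q * \<mu> x)
      \<le> (\<Sum>x\<in>B. K * (\<Sum>w\<in>S x. g w powr q) * \<mu> x)"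
    using pos by (intro sum_mono mult_right_mono pointwise) (auto simp: less_imp_le)
  also have "\<dots> = K * (\<Sum>x\<in>B. \<Sum>w\<in>S x. g w powr q * \<mu> x)"
    by (simp add: sum_distrib_left sum_distrib_right mult.assoc)
  \<comment> \<open>Exchange of summation: each \<open>w\<close> is weighted by the total mass of
    the vertices \<open>x\<close> whose walk passes through it.\<close>
  also have "(\<Sum>x\<in>B. \<Sum>w\<in>S x. g w powr q * \<mu> x) = (\<Sum>x\<in>B. \<Sum>w | w \<in> B \<and> w \<in> S x. g w powr q * \<mu> x)"
    using S(1) by (intro sum.cong) auto
  also have "\<dots> = (\<Sum>w\<in>B. \<Sum>x | x \<in> B \<and> w \<in> S x. g w powr q * \<mu> x)"
    using finB by (intro sum.swap_restrict) auto
  also have "\<dots> = (\<Sum>w\<in>B. g w powr q * (\<Sum>x | x \<in> B \<and> w \<in> S x. \<mu> x))"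
    by (simp add: sum_distrib_left)
  also have "K * \<dots> \<le> K * (\<Sum>w\<in>B. g w powr q * (3 * real n * (C * D) * \<mu> w))"
  proof (intro mult_left_mono sum_mono)
    fix w
    have "(\<Sum>x | x \<in> B \<and> w \<in> S x. \<mu> x) \<le> real (2 * n + 1) * (C * D) * \<mu> w"
      using S(4) finB by (intro sum_near_ancestor_le[OF flow pos C dbl D(2)]) auto
    also have "\<dots> \<le> 3 * real n * (C * D) * \<mu> w"
      using n C D(1) pos[of w] by (intro mult_right_mono) auto
    finally show "(\<Sum>x | x \<in> B \<and> w \<in> S x. \<mu> x) \<le> 3 * real n * (C * D) * \<mu> w" .
  qed (auto simp: K_def)
  also have "\<dots> = K * real n * (3 * (C * D)) * (\<Sum>w\<in>B. g w powr q * \<mu> w)"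
    by (simp add: sum_distrib_left mult_ac)
  \<comment> \<open>Jensen contributes \<open>n\<close> to the power \<open>q - 1\<close> and the
    overlap one more factor \<open>n\<close>.\<close>
  also have "K * real n = real (L + 3) powr (q - 1) * real n powr q"
    using n by (simp add: K_def powr_mult powr_diff)
  finally show ?thesis by (simp add: B_def g_def mult_ac)
qed

end

section \<open>From the apex to the average, and from integer to real radii\<close>

theorem theorem2p5:
  fixes adj :: "'a::countable \<Rightarrow> 'a \<Rightarrow> bool" and h :: "'a \<Rightarrow> int" and p :: "'a \<Rightarrow> 'a"
    and \<mu> :: "'a \<Rightarrow> real"
  assumes "spiderweb adj h p"
    and "\<exists>L\<^sub>0::nat. \<forall>x y. \<exists>zs xs. standard_geodesic adj h p x y zs xs \<and> walk_length zs \<le> L\<^sub>0"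
    and "quasi_flow p \<mu>"
    and "locally_doubling adj \<mu>"
  shows "\<forall>q::real. q \<ge> 1 \<longrightarrow> (\<exists>C::real. \<forall>(x\<^sub>c::'a) (r::real) (f::'a \<Rightarrow> complex). r > 0 \<longrightarrow>
    (\<Sum>x\<in>graph_ball adj x\<^sub>c r. cmod (f x - ball_average adj \<mu> x\<^sub>c r f) powr q * \<mu> x)
      \<le> C * r powr q * (\<Sum>x\<in>graph_ball adj x\<^sub>c r. grad_norm adj f x powr q * \<mu> x))"
proof (intro allI impI)
  fix q :: real assume q: "q \<ge> 1"
  interpret spiderweb adj h p by fact
  obtain L where L: "\<And>x y. \<exists>zs xs. standard_geodesic adj h p x y zs xs \<and> walk_length zs \<le> L"
    using assms(2) by blast
  obtain C where pos: "\<And>x. \<mu> x > 0" and C: "C \<ge> 1"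
    and flow: "\<And>n x. mass \<mu> (descendants p n x) \<le> ennreal (C * \<mu> x)"
    using assms(3) by (auto simp: quasi_flow_def)
  obtain D where D: "D \<ge> 0" "\<And>x. (\<Sum>y\<in>graph_ball adj x (real L). \<mu> y) \<le> D * \<mu> x"
    using ball_sum_le_of_locally_doubling[OF pos assms(4)] by blast
  define E where "E = real (L + 3) powr (q - 1) * (3 * (C * D))"
  have E: "E \<ge> 0" using C D(1) by (simp add: E_def)
  show "\<exists>C. \<forall>c r f. r > 0 \<longrightarrow>
    (\<Sum>x\<in>graph_ball adj c r. cmod (f x - ball_average adj \<mu> c r f) powr q * \<mu> x)
      \<le> C * r powr q * (\<Sum>x\<in>graph_ball adj c r. grad_norm adj f x powr q * \<mu> x)"
  proof (intro exI[of _ "2 powr q * E"] allI impI)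
    fix c and r :: real and f :: "'a \<Rightarrow> complex" assume r: "r > 0"
    \<comment> \<open>Distances are integers, so the balls of radius \<open>r\<close> and
      \<open>n\<close> coincide.\<close>
    define n where "n = nat \<lfloor>r\<rfloor>"
    define G where "G = (\<Sum>x\<in>graph_ball adj c r. grad_norm adj f x powr q * \<mu> x)"
    have G: "G \<ge> 0" using pos by (auto simp: G_def less_imp_le intro!: sum_nonneg)
    have "real d \<le> r \<longleftrightarrow> d \<le> n" for d using r by (simp add: n_def le_nat_iff le_floor_iff)
    then have ball: "graph_ball adj c r = graph_ball adj c (real n)"
      by (simp add: graph_ball_def)
    have fin: "finite (graph_ball adj c r)" by (rule finite_graph_ball[OF pos assms(4)])
    have c: "c \<in> graph_ball adj c r" using r graph_dist_eq_0_iff[of c c] by (simp add: graph_ball_def)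
    have "(\<Sum>x\<in>graph_ball adj c r. cmod (f x - f ((p ^^ n) c)) powr q * \<mu> x) \<le> E * real n powr q * G"
    \<comment> \<open>For \<open>n = 0\<close> the ball is \<open>{c}\<close> and the apex is
      \<open>c\<close> itself, so both sides vanish.\<close>
    proof (cases "n = 0")
      case True
      then have "graph_ball adj c r = {c}" unfolding ball
        by (auto simp: graph_ball_def graph_dist_eq_0_iff)
      then show ?thesis using True by simp
    next
      case False
      then show ?thesis
        using poincare_apex[OF L flow pos _ assms(4) D q, of n f c] C by (simp add: E_def G_def ball)
    qed
    also have "\<dots> \<le> E * r powr q * G"
      using E G q r by (intro mult_right_mono mult_left_mono powr_mono2) (auto simp: n_def)
    finally have "2 powr q * (\<Sum>x\<in>graph_ball adj c r. cmod (f x - f ((p ^^ n) c)) powr q * \<mu> x)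
        \<le> 2 powr q * E * r powr q * G"
      by (simp add: mult.assoc)
    moreover have "(\<Sum>x\<in>graph_ball adj c r. cmod (f x - ball_average adj \<mu> c r f) powr q * \<mu> x)
        \<le> 2 powr q * (\<Sum>x\<in>graph_ball adj c r. cmod (f x - f ((p ^^ n) c)) powr q * \<mu> x)"
      unfolding ball_average_def using c pos by (intro sum_dist_average_powr_le[OF q fin]) auto
    ultimately show "(\<Sum>x\<in>graph_ball adj c r. cmod (f x - ball_average adj \<mu> c r f) powr q * \<mu> x)
      \<le> 2 powr q * E * r powr q * (\<Sum>x\<in>graph_ball adj c r. grad_norm adj f x powr q * \<mu> x)"
      unfolding G_def by (rule order.trans[rotated])
  qed
qed

end
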